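(* Let $(X,r)$ be an involutive non-degenerate set-theoretic solution to the Yang--Baxter equation. Then each $\mathcal{G}(X,r)$-equivariant map $k\colon X\to X$ is a reflection of $(X,r)$.
   Context: A set-theoretic solution to the Yang--Baxter equation (YBE) is a pair $(X,r)$, where $X$ is a set and $r\colon X\times X\to X\times X$ is a bijective map with $(r\times\mathrm{id})(\mathrm{id}\times r)(r\times\mathrm{id})=(\mathrm{id}\times r)(r\times\mathrm{id})(\mathrm{id}\times r)$ on $X\times X\times X$. Write $r(x,y)=(\sigma_x(y),\tau_y(x))$. The solution is non-degenerate if all maps $\sigma_x,\tau_x\colon X\to X$ are bijective, and involutive if $r^2=\mathrm{id}_{X\times X}$. For a non-degenerate solution $(X,r)$, a map $k\colon X\to X$ is a reflection of $(X,r)$ if $r(\mathrm{id}\times k)r(\mathrm{id}\times k)=(\mathrm{id}\times k)r(\mathrm{id}\times k)r$. For an involutive non-degenerate solution, $\mathcal{G}(X,r)$ is the group of permutations of $X$ generated by $\{\sigma_x:x\in X\}$, acting on $X$ by evaluation; a map $k\colon X\to X$ is $\mathcal{G}(X,r)$-equivariant if $k(gx)=gk(x)$ for all $g\in\mathcal{G}(X,r)$ and $x\in X$ (equivalently $k\sigma_x=\sigma_xk$ for all $x\in X$). *)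

theory Defs
  imports "HOL-Algebra.Bij" "HOL-Algebra.Generated_Groups"
begin

text \<open>
  The underlying set is an arbitrary carrier \<open>X :: 'a set\<close>, possibly empty or infinite. Maps
  between carriers are HOL functions whose values outside the carrier are irrelevant, so
  identities between maps are required on the carrier only.
\<close>

definition sigma :: "('a \<times> 'a \<Rightarrow> 'a \<times> 'a) \<Rightarrow> 'a \<Rightarrow> 'a \<Rightarrow> 'a" where
  "sigma r x y = fst (r (x, y))"

text \<open>The subscript comes first: \<open>tau r y x\<close> is $\tau_y(x)$, so that $r(x,y) = (\sigma_x(y), \tau_y(x))$.\<close>

definition tau :: "('a \<times> 'a \<Rightarrow> 'a \<times> 'a) \<Rightarrow> 'a \<Rightarrow> 'a \<Rightarrow> 'a" where
  "tau r y x = snd (r (x, y))"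

text \<open>Triples nest to the right, so \<open>id \<times> r\<close> is \<open>map_prod id r\<close>, while \<open>r \<times> id\<close> has to be reassociated.\<close>

definition left_times_id :: "('a \<times> 'a \<Rightarrow> 'a \<times> 'a) \<Rightarrow> 'a \<times> 'a \<times> 'a \<Rightarrow> 'a \<times> 'a \<times> 'a" where
  "left_times_id r = (\<lambda>(x, y, z). (fst (r (x, y)), snd (r (x, y)), z))"

definition ybe_solution :: "'a set \<Rightarrow> ('a \<times> 'a \<Rightarrow> 'a \<times> 'a) \<Rightarrow> bool" where
  "ybe_solution X r \<longleftrightarrow>
     bij_betw r (X \<times> X) (X \<times> X) \<and>
     (\<forall>t \<in> X \<times> X \<times> X.
        (left_times_id r \<circ> map_prod id r \<circ> left_times_id r) t =
        (map_prod id r \<circ> left_times_id r \<circ> map_prod id r) t)"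

definition nondegenerate :: "'a set \<Rightarrow> ('a \<times> 'a \<Rightarrow> 'a \<times> 'a) \<Rightarrow> bool" where
  "nondegenerate X r \<longleftrightarrow>
     (\<forall>x \<in> X. bij_betw (sigma r x) X X \<and> bij_betw (tau r x) X X)"

definition involutive :: "'a set \<Rightarrow> ('a \<times> 'a \<Rightarrow> 'a \<times> 'a) \<Rightarrow> bool" where
  "involutive X r \<longleftrightarrow> (\<forall>p \<in> X \<times> X. (r \<circ> r) p = p)"

definition is_reflection :: "'a set \<Rightarrow> ('a \<times> 'a \<Rightarrow> 'a \<times> 'a) \<Rightarrow> ('a \<Rightarrow> 'a) \<Rightarrow> bool" where
  "is_reflection X r k \<longleftrightarrow>
     k \<in> X \<rightarrow> X \<and>
     (\<forall>p \<in> X \<times> X.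
        (r \<circ> map_prod id k \<circ> r \<circ> map_prod id k) p =
        (map_prod id k \<circ> r \<circ> map_prod id k \<circ> r) p)"

text \<open>
  Elements of \<open>BijGroup X\<close> are extensional functions on \<open>X\<close>, hence the restriction of the
  generators; for a non-degenerate \<open>r\<close> these restrictions do lie in \<open>BijGroup X\<close>.
\<close>

definition permutation_group :: "'a set \<Rightarrow> ('a \<times> 'a \<Rightarrow> 'a \<times> 'a) \<Rightarrow> ('a \<Rightarrow> 'a) monoid" where
  "permutation_group X r =
     (BijGroup X)\<lparr>carrier := generate (BijGroup X) ((\<lambda>x. restrict (sigma r x) X) ` X)\<rparr>"

definition equivariant :: "'a set \<Rightarrow> ('a \<times> 'a \<Rightarrow> 'a \<times> 'a) \<Rightarrow> ('a \<Rightarrow> 'a) \<Rightarrow> bool" where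
  "equivariant X r k \<longleftrightarrow>
     (\<forall>g \<in> carrier (permutation_group X r). \<forall>x \<in> X. k (g x) = g (k x))"

end

(* Involutivity says \<sigma>_s(t) = x for r(x, y) = (s, t), so the second component of r(x, y) is
   determined by x and \<sigma>_x(y). With a = \<sigma>_x(y) and k commuting with every \<sigma>, both sides of
   the reflection equation at (x, y) have first component k(x), and \<sigma>_{k(x)} sends both second
   components to k(a). *)
theory Submission
  imports Defs
begin

text \<open>Each generator lies in the generated group, and restricting it to \<open>X\<close> is
  harmless since \<open>y\<close> and \<open>k y\<close> both lie in \<open>X\<close>.\<close>

lemma equivariant_sigma:
  assumes "equivariant X r k" "k \<in> X \<rightarrow> X" "x \<in> X" "y \<in> X"
  shows "k (sigma r x y) = sigma r x (k y)"
proof -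
  have "restrict (sigma r x) X \<in> carrier (permutation_group X r)"
    unfolding permutation_group_def using \<open>x \<in> X\<close> by (auto intro: generate.incl)
  then have "k (restrict (sigma r x) X y) = restrict (sigma r x) X (k y)"
    using assms(1,4) unfolding equivariant_def by blast
  then show ?thesis
    using assms(2,4) by auto
qed

lemma sigma_tau_involutive:
  assumes "involutive X r" "x \<in> X" "y \<in> X"
  shows "sigma r (sigma r x y) (tau r y x) = x"
proof -
  have "r (r (x, y)) = (x, y)"
    using assms by (auto simp: involutive_def)
  then show ?thesis
    by (simp add: sigma_def tau_def)
qed

theorem theorem1p9:
  fixes X :: "'a set"
    and r :: "'a \<times> 'a \<Rightarrow> 'a \<times> 'a"
    and k :: "'a \<Rightarrow> 'a"
  assumes "ybe_solution X r"
    and "nondegenerate X r"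
    and "involutive X r"
    and "k \<in> X \<rightarrow> X"
    and "equivariant X r k"
  shows "is_reflection X r k"
  unfolding is_reflection_def
proof (intro conjI ballI)
  fix p assume "p \<in> X \<times> X"
  then obtain x y where p: "p = (x, y)" and x: "x \<in> X" and y: "y \<in> X"
    by auto
  have r: "r (u, v) = (sigma r u v, tau r v u)" for u v
    by (simp add: sigma_def tau_def)
  have k: "k u \<in> X" if "u \<in> X" for u
    using that assms(4) by auto
  have bij: "bij_betw (sigma r u) X X" "bij_betw (tau r u) X X" if "u \<in> X" for u
    using that assms(2) by (auto simp: nondegenerate_def)
  have S: "sigma r u v \<in> X" and T: "tau r v u \<in> X" if "u \<in> X" "v \<in> X" for u v
    using bij that by (auto dest: bij_betwE)
  have inj: "v = w" if "sigma r u v = sigma r u w" "u \<in> X" "v \<in> X" "w \<in> X" for u v w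
    using bij(1)[of u] that by (auto simp: bij_betw_def dest: inj_onD)
  note comm = equivariant_sigma[OF assms(5,4)]
  note inv = sigma_tau_involutive[OF assms(3)]
  define a where "a = sigma r x y"
  \<comment> \<open>Just before the last \<open>r\<close> is applied on each side of the equation,
    the left side has reached \<open>(k a, u)\<close> and the right side
    \<open>(a, v)\<close>.\<close>
  define u where "u = k (tau r (k y) x)"
  define v where "v = k (tau r y x)"
  have mem: "a \<in> X" "u \<in> X" "v \<in> X" "k a \<in> X"
    by (simp_all add: a_def u_def v_def x y k S T)
  have ka: "sigma r x (k y) = k a"
    by (simp add: a_def comm x y)
  \<comment> \<open>Involutivity at \<open>(x, k y)\<close> recovers \<open>x\<close>; applying
    \<open>k\<close> and moving it past \<open>sigma r (k a)\<close> gives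
    \<open>k x\<close>.\<close>
  have first_l: "sigma r (k a) u = k x"
    using inv[of x "k y"] comm[of "k a" "tau r (k y) x"]
    by (simp add: u_def ka mem x y k T)
  have first_r: "sigma r a v = k x"
    using inv[of x y] comm[of a "tau r y x"]
    by (simp add: v_def a_def x y S T)
  have second_l: "sigma r (k x) (tau r u (k a)) = k a"
    using inv[of "k a" u] by (simp add: first_l mem)
  \<comment> \<open>Involutivity at \<open>(a, v)\<close> gives
    \<open>sigma r (k x) (tau r v a) = a\<close>; the outer \<open>k\<close> on the right side is
    absorbed by commuting.\<close>
  have second_r: "sigma r (k x) (k (tau r v a)) = k a"
    using inv[of a v] comm[of "k x" "tau r v a"] by (simp add: first_r mem x k T)
  \<comment> \<open>Non-degeneracy makes \<open>sigma r (k x)\<close> injective, so equal images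
    force equal second components.\<close>
  have "tau r u (k a) = k (tau r v a)"
    by (rule inj[of "k x"]) (simp_all add: second_l second_r mem x k T)
  then show "(r \<circ> map_prod id k \<circ> r \<circ> map_prod id k) p =
      (map_prod id k \<circ> r \<circ> map_prod id k \<circ> r) p"
    by (simp add: p r ka first_l first_r flip: a_def u_def v_def)
qed (fact assms(4))

end
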